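(* Two uniquely 2-divisible nil$_2$-groups $G$, $G'$ are isomorphic as objects of $\mathbf{Niq}$ if and only if there exists an isomorphism of abelian groups $g:\log(G)\to\log(G')$ such that $g([G,G])=[G',G']$.
   Context: A nil$_2$-group is a group $G$ with $[[G,G],G]=0$. Write the group operation of $G$ as $\oplus$ and let $[a,b]=(\ominus a)\oplus(\ominus b)\oplus a\oplus b$. $G$ is uniquely 2-divisible if $x\mapsto x\oplus x$ is a bijection $G\to G$. For a uniquely 2-divisible nil$_2$-group $G$, $\log(G)$ is the nilpotent class two Lie $\mathbb Z[\frac12]$-algebra with underlying set $G$, addition $a+b:=a\oplus b\oplus\frac12[b,a]$ (where $\frac12 c$ is the unique element with $\frac12c\oplus\frac12c=c$) and bracket equal to the commutator map of $G$; here $\log(G)$ is regarded as an abelian group under this addition. For a map $f:G\to H$ of groups let $(a\mid b)_f:=\ominus(f(a)\oplus f(b))\oplus f(a\oplus b)$. The map $f$ is weakly quadratic if for all $a,b,c\in G$ the element $(a\mid b)_f$ commutes with $f(c)$ and is a homomorphism in $a$ and in $b$. A q-map is a weakly quadratic map $f:G\to H$ between nil$_2$-groups with $(a\mid b)_f\in[H,H]$ for all $a,b\in G$. $\mathbf{Niq}$ is the category of nil$_2$-groups and q-maps. *)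

theory Defs
  imports "HOL-Algebra.Generated_Groups"
begin

text \<open>Groups are written multiplicatively, so \<open>\<otimes>\<close>, \<open>\<one>\<close> and \<open>inv\<close> stand for the (non-commutative)
  sum, zero and \<open>\<ominus>\<close> of the source.\<close>

definition gcommutator :: "('a, 'm) monoid_scheme \<Rightarrow> 'a \<Rightarrow> 'a \<Rightarrow> 'a" where
  "gcommutator G a b = inv\<^bsub>G\<^esub> a \<otimes>\<^bsub>G\<^esub> inv\<^bsub>G\<^esub> b \<otimes>\<^bsub>G\<^esub> a \<otimes>\<^bsub>G\<^esub> b"

definition commutator_subgroup ::
    "('a, 'm) monoid_scheme \<Rightarrow> 'a set \<Rightarrow> 'a set \<Rightarrow> 'a set" where
  "commutator_subgroup G H K = generate G {gcommutator G a b | a b. a \<in> H \<and> b \<in> K}"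

text \<open>The library's derived subgroup is built from \<open>a \<otimes> b \<otimes> inv a \<otimes> inv b\<close>; the two conventions
  give the same subgroup.\<close>

lemma (in group) commutator_subgroup_eq_derived:
  "commutator_subgroup G (carrier G) (carrier G) = derived G (carrier G)"
proof -
  have "{gcommutator G a b | a b. a \<in> carrier G \<and> b \<in> carrier G} =
      (\<Union>h1 \<in> carrier G. \<Union>h2 \<in> carrier G. {h1 \<otimes> h2 \<otimes> inv h1 \<otimes> inv h2})" (is "?L = ?R")
  proof
    show "?L \<subseteq> ?R"
    proof
      fix x assume "x \<in> ?L"
      then obtain a b where "a \<in> carrier G" "b \<in> carrier G" "x = gcommutator G a b" by blast
      then have "x = inv a \<otimes> inv b \<otimes> inv (inv a) \<otimes> inv (inv b)"
        by (simp add: gcommutator_def)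
      with \<open>a \<in> carrier G\<close> \<open>b \<in> carrier G\<close> show "x \<in> ?R" using inv_closed by blast
    qed
    show "?R \<subseteq> ?L"
    proof
      fix x assume "x \<in> ?R"
      then obtain a b where ab: "a \<in> carrier G" "b \<in> carrier G"
        and "x = a \<otimes> b \<otimes> inv a \<otimes> inv b" by blast
      then have "x = gcommutator G (inv a) (inv b)"
        by (simp add: gcommutator_def)
      with ab show "x \<in> ?L" using inv_closed by blast
    qed
  qed
  then show ?thesis by (simp add: commutator_subgroup_def derived_def)
qed

definition nil2_group :: "('a, 'm) monoid_scheme \<Rightarrow> bool" where
  "nil2_group G \<longleftrightarrow> group G \<and>
     commutator_subgroup G (commutator_subgroup G (carrier G) (carrier G)) (carrier G) = {\<one>\<^bsub>G\<^esub>}"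

definition uniquely_2_divisible :: "('a, 'm) monoid_scheme \<Rightarrow> bool" where
  "uniquely_2_divisible G \<longleftrightarrow> bij_betw (\<lambda>x. x \<otimes>\<^bsub>G\<^esub> x) (carrier G) (carrier G)"

definition half :: "('a, 'm) monoid_scheme \<Rightarrow> 'a \<Rightarrow> 'a" where
  "half G c = (THE x. x \<in> carrier G \<and> x \<otimes>\<^bsub>G\<^esub> x = c)"

text \<open>The additive group of the Lie algebra \<open>log(G)\<close>. Only this group is needed, so the bracket
  (the commutator map of \<open>G\<close>) is not part of the structure.\<close>

definition log_group :: "('a, 'm) monoid_scheme \<Rightarrow> 'a monoid" where
  "log_group G = \<lparr>carrier = carrier G,
     mult = (\<lambda>a b. a \<otimes>\<^bsub>G\<^esub> b \<otimes>\<^bsub>G\<^esub> half G (gcommutator G b a)),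
     one = \<one>\<^bsub>G\<^esub>\<rparr>"

definition cross_effect ::
    "('a, 'm) monoid_scheme \<Rightarrow> ('b, 'n) monoid_scheme \<Rightarrow> ('a \<Rightarrow> 'b) \<Rightarrow> 'a \<Rightarrow> 'a \<Rightarrow> 'b" where
  "cross_effect G H f a b = inv\<^bsub>H\<^esub> (f a \<otimes>\<^bsub>H\<^esub> f b) \<otimes>\<^bsub>H\<^esub> f (a \<otimes>\<^bsub>G\<^esub> b)"

definition weakly_quadratic ::
    "('a, 'm) monoid_scheme \<Rightarrow> ('b, 'n) monoid_scheme \<Rightarrow> ('a \<Rightarrow> 'b) \<Rightarrow> bool" where
  "weakly_quadratic G H f \<longleftrightarrow>
     f \<in> carrier G \<rightarrow> carrier H \<and>
     (\<forall>a\<in>carrier G. \<forall>b\<in>carrier G. \<forall>c\<in>carrier G.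
        cross_effect G H f a b \<otimes>\<^bsub>H\<^esub> f c = f c \<otimes>\<^bsub>H\<^esub> cross_effect G H f a b) \<and>
     (\<forall>b\<in>carrier G. (\<lambda>a. cross_effect G H f a b) \<in> hom G H) \<and>
     (\<forall>a\<in>carrier G. (\<lambda>b. cross_effect G H f a b) \<in> hom G H)"

definition q_map ::
    "('a, 'm) monoid_scheme \<Rightarrow> ('b, 'n) monoid_scheme \<Rightarrow> ('a \<Rightarrow> 'b) \<Rightarrow> bool" where
  "q_map G H f \<longleftrightarrow>
     nil2_group G \<and> nil2_group H \<and> weakly_quadratic G H f \<and>
     (\<forall>a\<in>carrier G. \<forall>b\<in>carrier G.
        cross_effect G H f a b \<in> commutator_subgroup H (carrier H) (carrier H))"

text \<open>Isomorphism in the category \<open>Niq\<close> of nil-2-groups and q-maps. The inverse has to be a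
  q-map as well; only values on the carriers count.\<close>

definition Niq_isomorphic :: "('a, 'm) monoid_scheme \<Rightarrow> ('b, 'n) monoid_scheme \<Rightarrow> bool" where
  "Niq_isomorphic G H \<longleftrightarrow>
     (\<exists>f h. q_map G H f \<and> q_map H G h \<and>
        (\<forall>x\<in>carrier G. h (f x) = x) \<and> (\<forall>y\<in>carrier H. f (h y) = y))"

end

(* For a q-map f with cross effect phi, commutators satisfy f[a,b] = [fa,fb] phi(a,b) phi(b,a)^-1, so f
   preserves the derived subgroups, and f deviates from additivity on log(G) by the symmetric
   bilinear form (phi(a,b) + phi(b,a)) / 2. Hence a |-> f(a) - phi(a,a) / 2 is additive; it agrees
   with f on [G,G] and modulo [G',G'], which makes it bijective when f is invertible in Niq.
   Conversely, an additive g with g[G,G] = [G',G'] has cross effect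
   g([a,b] / 2) - [ga,gb] / 2, which is bilinear and central, so g is itself a q-map. *)

theory Submission
  imports Defs
begin

section \<open>Commutators in an arbitrary group\<close>

lemma (in group) mult_inv_cancel_left [simp]:
  assumes "x \<in> carrier G" "y \<in> carrier G"
  shows "x \<otimes> (inv x \<otimes> y) = y" "inv x \<otimes> (x \<otimes> y) = y"
  using assms by (simp_all flip: m_assoc)

lemma (in group) gcommutator_closed [simp]:
  "\<lbrakk>a \<in> carrier G; b \<in> carrier G\<rbrakk> \<Longrightarrow> gcommutator G a b \<in> carrier G"
  by (simp add: gcommutator_def)

lemma (in group) mult_eq_gcommutator:
  assumes "a \<in> carrier G" "b \<in> carrier G"
  shows "b \<otimes> a \<otimes> gcommutator G a b = a \<otimes> b"
  using assms by (simp add: gcommutator_def m_assoc)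

text \<open>Left cancellation of \<open>b \<otimes> a\<close>. Later proofs identify a commutator by
  solving this equation instead of expanding inverses.\<close>

lemma (in group) gcommutator_unique:
  assumes "a \<in> carrier G" "b \<in> carrier G" "c \<in> carrier G" "b \<otimes> a \<otimes> c = a \<otimes> b"
  shows "gcommutator G a b = c"
proof -
  have "b \<otimes> a \<otimes> gcommutator G a b = b \<otimes> a \<otimes> c"
    using assms by (simp add: mult_eq_gcommutator)
  then show ?thesis using assms by (metis Units_eq Units_l_cancel gcommutator_closed m_closed)
qed

section \<open>Central commutators, halving and log addition in one group\<close>

locale nil2_2div = group G for G (structure) +
  assumes nil2: "nil2_group G" and div2: "uniquely_2_divisible G"
begin

abbreviation D where "D \<equiv> commutator_subgroup G (carrier G) (carrier G)"

lemma D_subgroup: "subgroup D G"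
  unfolding commutator_subgroup_def by (rule generate_is_subgroup) auto

lemma D_carrier [simp]: "d \<in> D \<Longrightarrow> d \<in> carrier G"
  using D_subgroup subgroup.mem_carrier by fast

lemma D_mult [simp]: "\<lbrakk>d \<in> D; e \<in> D\<rbrakk> \<Longrightarrow> d \<otimes> e \<in> D"
  using D_subgroup subgroup.m_closed by fast

lemma D_inv [simp]: "d \<in> D \<Longrightarrow> inv d \<in> D"
  using D_subgroup subgroup.m_inv_closed by fast

lemma D_one [simp]: "\<one> \<in> D"
  using D_subgroup subgroup.one_closed by fast

lemma D_gcommutator [simp]:
  "\<lbrakk>a \<in> carrier G; b \<in> carrier G\<rbrakk> \<Longrightarrow> gcommutator G a b \<in> D"
  unfolding commutator_subgroup_def by (rule generate.incl) auto

text \<open>Induction over \<open>generate\<close>, strengthened by \<open>d \<in> D\<close> so that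
  membership is at hand in the inductive cases. Inverses of generators are absorbed into the general
  \<open>inv\<close> case.\<close>

lemma D_induct [consumes 1, case_names one incl inv mult]:
  assumes "d \<in> D" and "P \<one>"
    and "\<And>a b. \<lbrakk>a \<in> carrier G; b \<in> carrier G\<rbrakk> \<Longrightarrow> P (gcommutator G a b)"
    and "\<And>d. \<lbrakk>d \<in> D; P d\<rbrakk> \<Longrightarrow> P (inv d)"
    and "\<And>d e. \<lbrakk>d \<in> D; e \<in> D; P d; P e\<rbrakk> \<Longrightarrow> P (d \<otimes> e)"
  shows "P d"
proof -
  have "d \<in> generate G {gcommutator G a b | a b. a \<in> carrier G \<and> b \<in> carrier G}"
    using assms(1) unfolding commutator_subgroup_def .
  then have "d \<in> D \<and> P d"
    by induction (use assms(2-) in auto)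
  then show ?thesis ..
qed

text \<open>The commutator of \<open>d\<close> and \<open>x\<close> is a generator of [[G,G],G],
  which is trivial.\<close>

lemma D_comm:
  assumes "d \<in> D" "x \<in> carrier G"
  shows "d \<otimes> x = x \<otimes> d"
proof -
  have "gcommutator G d x \<in> commutator_subgroup G D (carrier G)"
    unfolding commutator_subgroup_def[of _ D] by (rule generate.incl) (use assms in blast)
  then have "gcommutator G d x = \<one>"
    using nil2 by (simp add: nil2_group_def)
  then show ?thesis
    using mult_eq_gcommutator[of d x] assms by simp
qed

lemma D_lcomm:
  assumes "d \<in> D" "x \<in> carrier G" "y \<in> carrier G"
  shows "d \<otimes> (x \<otimes> y) = x \<otimes> (d \<otimes> y)"
  using assms D_comm[of d x] by (simp add: m_assoc[symmetric])

text \<open>Ordered rewriting orients each swap one way only, so it needs the versions with the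
  central factor on either side.\<close>

lemmas D_ac = m_assoc D_comm D_comm[symmetric] D_lcomm D_lcomm[symmetric]

text \<open>The central factor [a,c] slides past \<open>b\<close>; then \<open>c\<close> is moved to
  the right past \<open>a\<close> and \<open>b\<close> in turn, each move absorbing one
  commutator.\<close>

lemma gcommutator_mult_left:
  assumes [simp]: "a \<in> carrier G" "b \<in> carrier G" "c \<in> carrier G"
  shows "gcommutator G (a \<otimes> b) c = gcommutator G a c \<otimes> gcommutator G b c"
proof (rule gcommutator_unique)
  have "c \<otimes> (a \<otimes> b) \<otimes> (gcommutator G a c \<otimes> gcommutator G b c)
      = c \<otimes> a \<otimes> (gcommutator G a c \<otimes> b) \<otimes> gcommutator G b c"
    by (simp add: m_assoc D_comm D_lcomm[of "gcommutator G a c"])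
  also have "\<dots> = (c \<otimes> a \<otimes> gcommutator G a c) \<otimes> b \<otimes> gcommutator G b c"
    by (simp add: m_assoc)
  also have "\<dots> = a \<otimes> c \<otimes> b \<otimes> gcommutator G b c"
    by (simp only: mult_eq_gcommutator assms)
  also have "\<dots> = a \<otimes> (c \<otimes> b \<otimes> gcommutator G b c)"
    by (simp add: m_assoc)
  also have "\<dots> = a \<otimes> (b \<otimes> c)"
    by (simp only: mult_eq_gcommutator assms)
  finally show "c \<otimes> (a \<otimes> b) \<otimes> (gcommutator G a c \<otimes> gcommutator G b c) = a \<otimes> b \<otimes> c"
    by (simp add: m_assoc)
qed auto

lemma gcommutator_inv:
  assumes [simp]: "a \<in> carrier G" "b \<in> carrier G"
  shows "inv (gcommutator G a b) = gcommutator G b a"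
  by (simp add: gcommutator_def inv_mult_group m_assoc)

text \<open>Follows from linearity on the left, since inversion swaps the arguments of a
  commutator.\<close>

lemma gcommutator_mult_right:
  assumes [simp]: "a \<in> carrier G" "b \<in> carrier G" "c \<in> carrier G"
  shows "gcommutator G a (b \<otimes> c) = gcommutator G a b \<otimes> gcommutator G a c"
proof -
  have "gcommutator G a (b \<otimes> c) = inv (gcommutator G b a \<otimes> gcommutator G c a)"
    by (simp flip: gcommutator_mult_left add: gcommutator_inv)
  then show ?thesis by (simp add: inv_mult_group gcommutator_inv D_comm)
qed

lemma gcommutator_D:
  assumes "d \<in> D" "x \<in> carrier G"
  shows "gcommutator G d x = \<one>" "gcommutator G x d = \<one>"
  by (rule gcommutator_unique; use assms in \<open>simp add: D_comm[OF assms]\<close>)+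

lemma half_unique:
  assumes "x \<in> carrier G" "x \<otimes> x = c"
  shows "half G c = x"
  unfolding half_def using assms div2
  by (intro the_equality) (auto simp: uniquely_2_divisible_def bij_betw_def inj_on_def)

lemma half_closed [simp]: "c \<in> carrier G \<Longrightarrow> half G c \<in> carrier G"
  and half_double: "c \<in> carrier G \<Longrightarrow> half G c \<otimes> half G c = c"
proof -
  assume "c \<in> carrier G"
  then have "c \<in> (\<lambda>x. x \<otimes> x) ` carrier G"
    using div2 by (simp add: uniquely_2_divisible_def bij_betw_def)
  then obtain x where x: "x \<in> carrier G" "x \<otimes> x = c" by blast
  then have "half G c = x" by (rule half_unique)
  with x show "half G c \<in> carrier G" "half G c \<otimes> half G c = c" by simp_all
qed

lemma half_one [simp]: "half G \<one> = \<one>"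
  by (rule half_unique) auto

text \<open>Bilinearity makes [a/2,b] the half of [a,b], so generators have their halves in
  \<open>D\<close>; centrality extends this to products.\<close>

lemma half_D [simp]: "d \<in> D \<Longrightarrow> half G d \<in> D"
proof (induction rule: D_induct)
  case (incl a b)
  then have "half G (gcommutator G a b) = gcommutator G (half G a) b"
    by (intro half_unique) (auto simp: half_double simp flip: gcommutator_mult_left)
  with incl show ?case by simp
next
  case (inv d)
  then have "half G (inv d) = inv (half G d)"
    by (intro half_unique) (auto simp: half_double simp flip: inv_mult_group)
  with inv show ?case by simp
next
  case (mult d e)
  have "(half G d \<otimes> half G e) \<otimes> (half G d \<otimes> half G e) = (half G d \<otimes> half G d) \<otimes> (half G e \<otimes> half G e)"
    using mult by (simp add: D_ac)
  with mult have "half G (d \<otimes> e) = half G d \<otimes> half G e"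
    by (intro half_unique) (simp_all add: half_double)
  with mult show ?case by simp
qed auto

lemma half_mult:
  assumes [simp]: "d \<in> D" "e \<in> D"
  shows "half G (d \<otimes> e) = half G d \<otimes> half G e"
proof (rule half_unique)
  have "(half G d \<otimes> half G e) \<otimes> (half G d \<otimes> half G e) = (half G d \<otimes> half G d) \<otimes> (half G e \<otimes> half G e)"
    by (simp add: D_ac)
  then show "(half G d \<otimes> half G e) \<otimes> (half G d \<otimes> half G e) = d \<otimes> e"
    by (simp add: half_double)
qed simp

lemma half_inv:
  assumes [simp]: "d \<in> D"
  shows "half G (inv d) = inv (half G d)"
  by (rule half_unique) (auto simp: half_double simp flip: inv_mult_group)

lemma log_mult_D:
  assumes "x \<in> carrier G" "d \<in> D"
  shows "x \<otimes>\<^bsub>log_group G\<^esub> d = x \<otimes> d"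
  using assms by (simp add: log_group_def gcommutator_D)

lemma log_mult_closed:
  "\<lbrakk>a \<in> carrier G; b \<in> carrier G\<rbrakk> \<Longrightarrow> a \<otimes>\<^bsub>log_group G\<^esub> b \<in> carrier G"
  by (simp add: log_group_def)

text \<open>Recovers the group operation from log addition: the halves of [b,a] and [a,b] are
  mutually inverse, and adding an element of \<open>D\<close> is the same as multiplying by
  it.\<close>

lemma mult_eq_log_mult:
  assumes [simp]: "a \<in> carrier G" "b \<in> carrier G"
  shows "a \<otimes> b = (a \<otimes>\<^bsub>log_group G\<^esub> b) \<otimes>\<^bsub>log_group G\<^esub> half G (gcommutator G a b)"
proof -
  have "half G (gcommutator G b a) \<otimes> half G (gcommutator G a b) = \<one>"
    by (simp flip: half_mult) (simp flip: gcommutator_inv[of a b])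
  then show ?thesis
    by (simp add: log_mult_D log_mult_closed) (simp add: log_group_def m_assoc)
qed

end

section \<open>Additive maps that respect derived subgroups are q-maps\<close>

locale nil2_2div_pair = G: nil2_2div G + H: nil2_2div H
  for G (structure) and H (structure)
begin

text \<open>A homomorphism with central values sends each commutator to a commutator of central
  elements. Applied to a cross effect in one variable, this shows that it vanishes on
  \<open>G.D\<close>.\<close>

lemma hom_D_trivial:
  assumes k: "k \<in> hom G H" and kD: "\<And>a. a \<in> carrier G \<Longrightarrow> k a \<in> H.D" and "d \<in> G.D"
  shows "k d = \<one>\<^bsub>H\<^esub>"
proof -
  interpret k: group_hom G H k by unfold_locales (rule k)
  from \<open>d \<in> G.D\<close> show ?thesis
  proof (induction rule: G.D_induct)
    case (incl a b)
    have "k (gcommutator G a b) = gcommutator H (k a) (k b)"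
      using incl by (simp add: gcommutator_def)
    with incl show ?case by (simp add: H.gcommutator_D kD)
  qed auto
qed

text \<open>Passing between products and log sums on both sides exhibits the cross effect as a
  product of two bilinear terms in \<open>H.D\<close>. The form of the hypotheses suits an
  isomorphism and its inverse alike.\<close>

lemma q_map_if_log_hom:
  assumes hom: "g \<in> hom (log_group G) (log_group H)" and gD: "g ` G.D \<subseteq> H.D"
  shows "q_map G H g"
proof -
  have g [simp]: "g a \<in> carrier H" if "a \<in> carrier G" for a
    using hom that by (auto simp: hom_def log_group_def)
  have gD [simp]: "g d \<in> H.D" if "d \<in> G.D" for d
    using gD that by blast
  have add: "g (a \<otimes>\<^bsub>log_group G\<^esub> b) = g a \<otimes>\<^bsub>log_group H\<^esub> g b"
    if "a \<in> carrier G" "b \<in> carrier G" for a b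
    using hom that by (simp add: hom_def log_group_def)
  have g_mult_D: "g (a \<otimes> d) = g a \<otimes>\<^bsub>H\<^esub> g d" if "a \<in> carrier G" "d \<in> G.D" for a d
    using that add[of a d] by (simp add: G.log_mult_D H.log_mult_D)
  \<comment> \<open>The prospective cross effect: the first factor comes from the log sum of
    \<open>g a\<close> and \<open>g b\<close> in \<open>H\<close>, the second from writing
    \<open>a \<otimes> b\<close> as a log sum in \<open>G\<close>.\<close>
  define w where "w a b = half H (gcommutator H (g b) (g a)) \<otimes>\<^bsub>H\<^esub> g (half G (gcommutator G a b))" for a b
  have wD [simp]: "w a b \<in> H.D" if "a \<in> carrier G" "b \<in> carrier G" for a b
    using that by (simp add: w_def)
  have g_mult: "g (a \<otimes> b) = g a \<otimes>\<^bsub>H\<^esub> g b \<otimes>\<^bsub>H\<^esub> w a b"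
    if [simp]: "a \<in> carrier G" "b \<in> carrier G" for a b
  proof -
    have "g (a \<otimes> b) = (g a \<otimes>\<^bsub>log_group H\<^esub> g b) \<otimes>\<^bsub>log_group H\<^esub> g (half G (gcommutator G a b))"
      by (simp add: G.mult_eq_log_mult add G.log_mult_closed)
    also have "\<dots> = (g a \<otimes>\<^bsub>log_group H\<^esub> g b) \<otimes>\<^bsub>H\<^esub> g (half G (gcommutator G a b))"
      by (simp add: H.log_mult_D H.log_mult_closed)
    finally show ?thesis
      by (simp add: w_def log_group_def H.m_assoc)
  qed
  have ce: "cross_effect G H g a b = w a b" if "a \<in> carrier G" "b \<in> carrier G" for a b
    using that by (simp add: cross_effect_def g_mult H.inv_solve_left')
  \<comment> \<open>Although \<open>g\<close> need not be multiplicative, its defect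
    \<open>w\<close> is central and hence invisible to commutators.\<close>
  have comm: "gcommutator H (g b) (g (a \<otimes> a')) = gcommutator H (g b) (g a) \<otimes>\<^bsub>H\<^esub> gcommutator H (g b) (g a')"
    "gcommutator H (g (a \<otimes> a')) (g b) = gcommutator H (g a) (g b) \<otimes>\<^bsub>H\<^esub> gcommutator H (g a') (g b)"
    if "a \<in> carrier G" "a' \<in> carrier G" "b \<in> carrier G" for a a' b
    using that
    by (simp_all add: g_mult H.gcommutator_mult_left H.gcommutator_mult_right H.gcommutator_D)
  have bil: "w (a \<otimes> a') b = w a b \<otimes>\<^bsub>H\<^esub> w a' b" "w b (a \<otimes> a') = w b a \<otimes>\<^bsub>H\<^esub> w b a'"
    if "a \<in> carrier G" "a' \<in> carrier G" "b \<in> carrier G" for a a' b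
    using that
    by (simp_all add: w_def comm G.gcommutator_mult_left G.gcommutator_mult_right G.half_mult
        H.half_mult g_mult_D H.D_ac)
  show ?thesis
    using G.nil2 H.nil2
    by (auto simp: q_map_def weakly_quadratic_def hom_def ce bil H.D_comm)
qed

end

section \<open>Cross effect and additive part of a q-map\<close>

locale q_map_2div = nil2_2div_pair G H for G (structure) and H (structure) +
  fixes f
  assumes q: "q_map G H f"
begin

abbreviation \<phi> where "\<phi> \<equiv> cross_effect G H f"

lemma f_closed [simp]: "a \<in> carrier G \<Longrightarrow> f a \<in> carrier H"
  using q by (auto simp: q_map_def weakly_quadratic_def)

lemma \<phi>_D [simp]: "\<lbrakk>a \<in> carrier G; b \<in> carrier G\<rbrakk> \<Longrightarrow> \<phi> a b \<in> H.D"
  using q by (auto simp: q_map_def)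

lemma \<phi>_hom:
  "b \<in> carrier G \<Longrightarrow> (\<lambda>a. \<phi> a b) \<in> hom G H"
  "a \<in> carrier G \<Longrightarrow> \<phi> a \<in> hom G H"
  using q by (auto simp: q_map_def weakly_quadratic_def)

lemma \<phi>_mult:
  assumes "a \<in> carrier G" "a' \<in> carrier G" "b \<in> carrier G"
  shows "\<phi> (a \<otimes> a') b = \<phi> a b \<otimes>\<^bsub>H\<^esub> \<phi> a' b" "\<phi> b (a \<otimes> a') = \<phi> b a \<otimes>\<^bsub>H\<^esub> \<phi> b a'"
  using \<phi>_hom[of b] assms by (auto simp: hom_def)

lemma \<phi>_trivial [simp]:
  assumes "a \<in> carrier G" "d \<in> G.D"
  shows "\<phi> a d = \<one>\<^bsub>H\<^esub>" "\<phi> d a = \<one>\<^bsub>H\<^esub>"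
  using hom_D_trivial[OF \<phi>_hom(1)[of a]] hom_D_trivial[OF \<phi>_hom(2)[of a]] assms by auto

lemma f_mult:
  assumes "a \<in> carrier G" "b \<in> carrier G"
  shows "f (a \<otimes> b) = f a \<otimes>\<^bsub>H\<^esub> f b \<otimes>\<^bsub>H\<^esub> \<phi> a b"
  using assms by (simp add: cross_effect_def H.m_assoc[symmetric])

lemma f_mult_D:
  assumes "a \<in> carrier G" "d \<in> G.D"
  shows "f (a \<otimes> d) = f a \<otimes>\<^bsub>H\<^esub> f d"
  using assms by (simp add: f_mult)

text \<open>Apply \<open>f\<close> to b a [a,b] = a b, expand both sides by cross effects and cancel
  \<open>f b\<close> times \<open>f a\<close>. The cross effect with [a,b] is trivial.\<close>

lemma f_gcommutator:
  assumes [simp]: "a \<in> carrier G" "b \<in> carrier G"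
  shows "f (gcommutator G a b) = gcommutator H (f a) (f b) \<otimes>\<^bsub>H\<^esub> \<phi> a b \<otimes>\<^bsub>H\<^esub> inv\<^bsub>H\<^esub> \<phi> b a"
proof -
  have "f b \<otimes>\<^bsub>H\<^esub> f a \<otimes>\<^bsub>H\<^esub> (\<phi> b a \<otimes>\<^bsub>H\<^esub> f (gcommutator G a b)) = f (b \<otimes> a \<otimes> gcommutator G a b)"
    by (simp add: f_mult_D) (simp add: f_mult H.m_assoc)
  also have "\<dots> = f b \<otimes>\<^bsub>H\<^esub> f a \<otimes>\<^bsub>H\<^esub> gcommutator H (f a) (f b) \<otimes>\<^bsub>H\<^esub> \<phi> a b"
    by (simp add: G.mult_eq_gcommutator H.mult_eq_gcommutator f_mult)
  also have "\<dots> = f b \<otimes>\<^bsub>H\<^esub> f a \<otimes>\<^bsub>H\<^esub> (gcommutator H (f a) (f b) \<otimes>\<^bsub>H\<^esub> \<phi> a b)"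
    by (simp add: H.m_assoc)
  finally have "\<phi> b a \<otimes>\<^bsub>H\<^esub> f (gcommutator G a b) = gcommutator H (f a) (f b) \<otimes>\<^bsub>H\<^esub> \<phi> a b"
    by (subst (asm) H.Units_l_cancel) (simp_all add: H.Units_eq)
  then have "f (gcommutator G a b) = inv\<^bsub>H\<^esub> \<phi> b a \<otimes>\<^bsub>H\<^esub> (gcommutator H (f a) (f b) \<otimes>\<^bsub>H\<^esub> \<phi> a b)"
    by (subst H.inv_solve_left) simp_all
  also have "\<dots> = gcommutator H (f a) (f b) \<otimes>\<^bsub>H\<^esub> \<phi> a b \<otimes>\<^bsub>H\<^esub> inv\<^bsub>H\<^esub> \<phi> b a"
    by (rule H.D_comm) simp_all
  finally show ?thesis .
qed

lemma f_one: "f \<one> = \<one>\<^bsub>H\<^esub>"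
  using f_mult_D[of \<one> \<one>] by simp

lemma f_D [simp]: "d \<in> G.D \<Longrightarrow> f d \<in> H.D"
proof (induction rule: G.D_induct)
  case (inv d)
  then have "f (inv d) = inv\<^bsub>H\<^esub> f d"
    using f_mult_D[of "inv d" d] by (intro H.inv_equality[symmetric]) (auto simp: f_one)
  with inv show ?case by simp
qed (auto simp: f_one f_gcommutator f_mult_D)

lemma f_half:
  assumes [simp]: "d \<in> G.D"
  shows "f (half G d) = half H (f d)"
  by (rule H.half_unique[symmetric]) (auto simp: G.half_double simp flip: f_mult_D)

text \<open>The product a b contributes \<phi>(a,b), that is, two copies of its half. The factor
  [b,a]/2 contributes [f b, f a]/2 together with \<phi>(b,a)/2 - \<phi>(a,b)/2, which cancels one
  copy.\<close>

lemma f_log_mult: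
  assumes [simp]: "a \<in> carrier G" "b \<in> carrier G"
  shows "f (a \<otimes>\<^bsub>log_group G\<^esub> b) =
    (f a \<otimes>\<^bsub>log_group H\<^esub> f b) \<otimes>\<^bsub>H\<^esub> (half H (\<phi> a b) \<otimes>\<^bsub>H\<^esub> half H (\<phi> b a))"
proof -
  let ?p = "half H (\<phi> a b)" and ?q = "half H (\<phi> b a)"
    and ?c = "half H (gcommutator H (f b) (f a))"
  have "f (a \<otimes>\<^bsub>log_group G\<^esub> b) = f a \<otimes>\<^bsub>H\<^esub> f b \<otimes>\<^bsub>H\<^esub> (?p \<otimes>\<^bsub>H\<^esub> ?p) \<otimes>\<^bsub>H\<^esub> (?c \<otimes>\<^bsub>H\<^esub> ?q \<otimes>\<^bsub>H\<^esub> inv\<^bsub>H\<^esub> ?p)"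
    by (simp add: log_group_def f_mult_D f_half f_gcommutator H.half_mult H.half_inv)
      (simp add: f_mult H.half_double)
  also have "\<dots> = f a \<otimes>\<^bsub>H\<^esub> f b \<otimes>\<^bsub>H\<^esub> ?c \<otimes>\<^bsub>H\<^esub> ?p \<otimes>\<^bsub>H\<^esub> ?q \<otimes>\<^bsub>H\<^esub> (?p \<otimes>\<^bsub>H\<^esub> inv\<^bsub>H\<^esub> ?p)"
    by (simp only: H.D_ac H.half_D H.D_inv \<phi>_D H.D_gcommutator H.D_carrier H.m_closed f_closed assms)
  finally show ?thesis
    by (simp add: log_group_def H.m_assoc)
qed

text \<open>The subtracted quadratic map has polarization (\<phi>(a,b) + \<phi>(b,a))/2, exactly the
  deviation of \<open>f\<close> from additivity in \<open>f_log_mult\<close>.\<close>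

definition linear_part where "linear_part a = f a \<otimes>\<^bsub>H\<^esub> inv\<^bsub>H\<^esub> half H (\<phi> a a)"

lemma linear_part_closed [simp]: "a \<in> carrier G \<Longrightarrow> linear_part a \<in> carrier H"
  by (simp add: linear_part_def)

text \<open>Multiplying by \<open>d\<close> leaves \<phi>(a,a) unchanged, because \<phi> is bilinear
  and vanishes on \<open>G.D\<close>.\<close>

lemma linear_part_mult_D:
  assumes "a \<in> carrier G" "d \<in> G.D"
  shows "linear_part (a \<otimes> d) = linear_part a \<otimes>\<^bsub>H\<^esub> f d"
  using assms by (simp add: linear_part_def f_mult_D \<phi>_mult H.D_ac)

lemma linear_part_D: "d \<in> G.D \<Longrightarrow> linear_part d = f d"
  by (simp add: linear_part_def)

lemma linear_part_hom: "linear_part \<in> hom (log_group G) (log_group H)"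
proof -
  have "linear_part (a \<otimes>\<^bsub>log_group G\<^esub> b) = linear_part a \<otimes>\<^bsub>log_group H\<^esub> linear_part b"
    if [simp]: "a \<in> carrier G" "b \<in> carrier G" for a b
  proof -
    let ?aa = "half H (\<phi> a a)" and ?bb = "half H (\<phi> b b)"
      and ?s = "half H (\<phi> a b) \<otimes>\<^bsub>H\<^esub> half H (\<phi> b a)"
    \<comment> \<open>The log sum differs from \<open>a \<otimes> b\<close> by an element of
      \<open>G.D\<close>, which \<phi> ignores.\<close>
    have "\<phi> (a \<otimes>\<^bsub>log_group G\<^esub> b) (a \<otimes>\<^bsub>log_group G\<^esub> b) = \<phi> (a \<otimes> b) (a \<otimes> b)"
      by (simp add: log_group_def \<phi>_mult)
    also have "half H \<dots> = ?aa \<otimes>\<^bsub>H\<^esub> ?bb \<otimes>\<^bsub>H\<^esub> ?s"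
      by (simp add: \<phi>_mult H.half_mult H.D_ac)
    finally have "linear_part (a \<otimes>\<^bsub>log_group G\<^esub> b) =
      (f a \<otimes>\<^bsub>log_group H\<^esub> f b) \<otimes>\<^bsub>H\<^esub> ?s \<otimes>\<^bsub>H\<^esub> (inv\<^bsub>H\<^esub> ?s \<otimes>\<^bsub>H\<^esub> inv\<^bsub>H\<^esub> (?aa \<otimes>\<^bsub>H\<^esub> ?bb))"
      by (simp add: linear_part_def f_log_mult H.inv_mult_group H.m_assoc)
    also have "\<dots> = (f a \<otimes>\<^bsub>log_group H\<^esub> f b) \<otimes>\<^bsub>H\<^esub> (?s \<otimes>\<^bsub>H\<^esub> inv\<^bsub>H\<^esub> ?s) \<otimes>\<^bsub>H\<^esub> inv\<^bsub>H\<^esub> (?aa \<otimes>\<^bsub>H\<^esub> ?bb)"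
      by (simp only: H.m_assoc H.log_mult_closed H.half_D H.D_mult H.D_inv \<phi>_D H.D_carrier
          H.m_closed H.inv_closed f_closed that)
    also have "\<dots> = (f a \<otimes>\<^bsub>log_group H\<^esub> f b) \<otimes>\<^bsub>H\<^esub> inv\<^bsub>H\<^esub> (?aa \<otimes>\<^bsub>H\<^esub> ?bb)"
      by (simp add: H.log_mult_closed)
    \<comment> \<open>The two corrections lie in \<open>H.D\<close>, so they do not affect the
      commutator in the log sum.\<close>
    also have "\<dots> = linear_part a \<otimes>\<^bsub>log_group H\<^esub> linear_part b"
      by (simp add: linear_part_def log_group_def H.gcommutator_mult_left H.gcommutator_mult_right
          H.gcommutator_D H.inv_mult_group H.D_ac)
    finally show ?thesis .
  qed
  then show ?thesis by (auto simp: hom_def) (simp_all add: log_group_def)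
qed

text \<open>The corrections lie in \<open>H.D\<close> and so have the form \<open>f d\<close> with
  \<open>d \<in> G.D\<close>; they can therefore be traded for factors in
  \<open>G.D\<close>.\<close>

lemma linear_part_iso:
  assumes bij: "bij_betw f (carrier G) (carrier H)" and onto: "H.D \<subseteq> f ` G.D"
  shows "linear_part \<in> iso (log_group G) (log_group H)"
proof -
  have "inj_on linear_part (carrier G)"
  proof (rule inj_onI)
    fix a b
    assume [simp]: "a \<in> carrier G" "b \<in> carrier G" and eq: "linear_part a = linear_part b"
    let ?aa = "half H (\<phi> a a)" and ?bb = "half H (\<phi> b b)"
    have "f a = linear_part a \<otimes>\<^bsub>H\<^esub> ?aa"
      by (simp add: linear_part_def H.m_assoc)
    also have "\<dots> = f b \<otimes>\<^bsub>H\<^esub> (inv\<^bsub>H\<^esub> ?bb \<otimes>\<^bsub>H\<^esub> ?aa)"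
      by (simp add: eq) (simp add: linear_part_def H.m_assoc)
    finally have fa: "f a = f b \<otimes>\<^bsub>H\<^esub> (inv\<^bsub>H\<^esub> ?bb \<otimes>\<^bsub>H\<^esub> ?aa)" .
    \<comment> \<open>Equal additive parts force \<open>a\<close> and \<open>b\<close> to differ by
      some \<open>d \<in> G.D\<close>. Then \<phi>(a,a) = \<phi>(b,b), so the corrections
      agree.\<close>
    have "inv\<^bsub>H\<^esub> ?bb \<otimes>\<^bsub>H\<^esub> ?aa \<in> f ` G.D"
      using onto by (rule subsetD) simp
    then obtain d where [simp]: "d \<in> G.D" and d: "inv\<^bsub>H\<^esub> ?bb \<otimes>\<^bsub>H\<^esub> ?aa = f d"
      by (rule imageE)
    have "f a = f (b \<otimes> d)" by (simp add: f_mult_D fa d)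
    then have "a = b \<otimes> d"
      using bij by (auto simp: bij_betw_def dest: inj_onD)
    then have "\<phi> a a = \<phi> b b" by (simp add: \<phi>_mult)
    with eq have "f a = f b" by (simp add: linear_part_def)
    then show "a = b"
      using bij by (auto simp: bij_betw_def dest: inj_onD)
  qed
  moreover have "carrier H \<subseteq> linear_part ` carrier G"
  proof
    fix y assume "y \<in> carrier H"
    then obtain a where [simp]: "a \<in> carrier G" and y: "y = f a"
      using bij by (auto simp: bij_betw_def)
    \<comment> \<open>Shifting \<open>a\<close> by the preimage \<open>d\<close> of its own
      correction compensates for what \<open>linear_part\<close> subtracts, without changing that
      correction.\<close>
    have "half H (\<phi> a a) \<in> f ` G.D"
      using onto by (rule subsetD) simp
    then obtain d where [simp]: "d \<in> G.D" and d: "half H (\<phi> a a) = f d"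
      by (rule imageE)
    have "linear_part (a \<otimes> d) = y"
      by (simp add: linear_part_mult_D) (simp add: linear_part_def y d H.m_assoc)
    then show "y \<in> linear_part ` carrier G" by force
  qed
  ultimately show ?thesis
    using linear_part_hom by (auto simp: iso_def bij_betw_def log_group_def)
qed

end

section \<open>The two implications\<close>

lemma (in nil2_2div_pair) Niq_isomorphic_imp_log_iso:
  assumes "Niq_isomorphic G H"
  shows "\<exists>g \<in> iso (log_group G) (log_group H). g ` G.D = H.D"
proof -
  obtain f h where "q_map G H f" "q_map H G h"
    and hf: "\<And>x. x \<in> carrier G \<Longrightarrow> h (f x) = x" and fh: "\<And>y. y \<in> carrier H \<Longrightarrow> f (h y) = y"
    using assms by (auto simp: Niq_isomorphic_def)
  interpret f: q_map_2div G H f by unfold_locales fact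
  interpret h: q_map_2div H G h by unfold_locales fact
  have bij: "bij_betw f (carrier G) (carrier H)"
    by (rule bij_betw_byWitness[where f' = h]) (auto simp: hf fh)
  \<comment> \<open>Each of \<open>f\<close> and \<open>h\<close> preserves derived subgroups, so
    mutual inverseness turns the two inclusions into an equality.\<close>
  have fD: "f ` G.D = H.D"
  proof
    show "H.D \<subseteq> f ` G.D"
    proof
      fix d assume "d \<in> H.D"
      then show "d \<in> f ` G.D" by (intro image_eqI[of _ _ "h d"]) (auto simp: fh)
    qed
  qed auto
  have "f.linear_part \<in> iso (log_group G) (log_group H)"
    by (rule f.linear_part_iso[OF bij]) (simp add: fD)
  moreover have "f.linear_part ` G.D = H.D"
    using fD by (simp add: f.linear_part_D cong: image_cong)
  ultimately show ?thesis by blast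
qed

lemma (in nil2_2div_pair) log_iso_imp_Niq_isomorphic:
  assumes g: "g \<in> iso (log_group G) (log_group H)" and gD: "g ` G.D = H.D"
  shows "Niq_isomorphic G H"
proof -
  \<comment> \<open>The roles are exchanged so that \<open>q_map_if_log_hom\<close> also covers the
    inverse of \<open>g\<close>.\<close>
  interpret HG: nil2_2div_pair H G by unfold_locales
  have hom: "g \<in> hom (log_group G) (log_group H)" and bij: "bij_betw g (carrier G) (carrier H)"
    using g by (auto simp: iso_def log_group_def)
  define k where "k = inv_into (carrier G) g"
  have kg: "k (g x) = x" if "x \<in> carrier G" for x
    using bij that by (simp add: k_def bij_betw_def)
  have gk: "g (k y) = y" and k_closed: "k y \<in> carrier G" if "y \<in> carrier H" for y
    using bij that by (auto simp: k_def bij_betw_def f_inv_into_f inv_into_into)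
  have "k (x \<otimes>\<^bsub>log_group H\<^esub> y) = k x \<otimes>\<^bsub>log_group G\<^esub> k y"
    if "x \<in> carrier H" "y \<in> carrier H" for x y
  proof -
    have "g (k x \<otimes>\<^bsub>log_group G\<^esub> k y) = x \<otimes>\<^bsub>log_group H\<^esub> y"
      using hom that by (simp add: hom_def log_group_def gk k_closed)
    then show ?thesis
      using kg[of "k x \<otimes>\<^bsub>log_group G\<^esub> k y"] that by (simp add: G.log_mult_closed k_closed)
  qed
  then have "k \<in> hom (log_group H) (log_group G)"
    by (auto simp: hom_def) (simp_all add: log_group_def k_closed)
  moreover have "k ` H.D \<subseteq> G.D"
    using kg by (auto simp flip: gD)
  ultimately have "q_map H G k" by (rule HG.q_map_if_log_hom)
  moreover have "q_map G H g"
    using hom gD by (intro q_map_if_log_hom) auto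
  ultimately show ?thesis
    using kg gk by (auto simp: Niq_isomorphic_def)
qed

theorem theorem8p1:
  fixes G :: "('a, 'm) monoid_scheme" and G' :: "('b, 'n) monoid_scheme"
  assumes "nil2_group G" and "uniquely_2_divisible G"
    and "nil2_group G'" and "uniquely_2_divisible G'"
  shows "Niq_isomorphic G G' \<longleftrightarrow>
    (\<exists>g \<in> iso (log_group G) (log_group G').
       g ` commutator_subgroup G (carrier G) (carrier G) =
       commutator_subgroup G' (carrier G') (carrier G'))"
proof -
  interpret nil2_2div_pair G G'
    using assms
    by (simp add: nil2_2div_pair_def nil2_2div_def nil2_2div_axioms_def nil2_group_def)
  show ?thesis
    using Niq_isomorphic_imp_log_iso log_iso_imp_Niq_isomorphic by blast
qed

end
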